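(* Let $M$ be a matroid on a finite set $E$ with a fixed linear order. For any linear extension $\prec$ of the external/internal order $\le_{ext/int}$ restricted to the nbc sets of $M$, listing the facets $G(I)$ of the augmented nbc complex $\Delta^{\mathrm{nbc}}_M$ in the order $\prec$ is a shelling order.
   Context: Activities: for $S\subseteq E$, $e\in E\setminus S$ is externally active w.r.t. $S$ if there is a circuit $\gamma\subseteq S\cup\{e\}$ of $M$ with $e=\max\gamma$; set $\operatorname{EA}(S)$. An element $i\in S$ is internally active w.r.t. $S$ if it is externally active w.r.t. $E\setminus S$ in the dual matroid $M^\perp$ (same order); set $\operatorname{IA}(S)$. Every independent set $I$ is uniquely $B\setminus Y$ with $B$ a basis ($B_I$, the related basis) and $Y\subseteq\operatorname{IA}(B)$; internally related = same related basis. nbc sets: a broken circuit is a circuit with its maximum element removed; an nbc set is a subset containing no broken circuit; equivalently an independent set $I$ with $\operatorname{EA}(I)=\emptyset$. They form the complex $\mathrm{NBC}(M)$. Order: $I\le_{ext/int}J$ iff either $I,J$ not internally related and $(I\setminus\operatorname{IA}(I))\cup\operatorname{EA}(I)\subseteq(J\setminus\operatorname{IA}(J))\cup\operatorname{EA}(J)$, or internally related and $I\subseteq J$. Augmented nbc complex $\Delta^{\mathrm{nbc}}_M$: vertex set $\{y_e,z_e:e\in E\}$, facets $G(I)=y_{B_I\setminus I}z_I$ for every nbc set $I$, where $y_S=\{y_e:e\in S\}$, $z_S=\{z_e:e\in S\}$. Shelling order: ordering $F_1,\dots,F_s$ of facets of a pure complex such that for all $i<k$ there exist $j<k$ and a vertex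 $e\in F_k$ with $F_i\cap F_k\subseteq F_j\cap F_k=F_k\setminus\{e\}$. *)

theory Defs
  imports Main
begin

locale matroid =
  fixes E :: "'a set" and indep :: "'a set \<Rightarrow> bool"
  assumes finite_ground: "finite E"
    and indep_subset_ground: "indep X \<Longrightarrow> X \<subseteq> E"
    and indep_empty: "indep {}"
    and indep_subset: "indep X \<Longrightarrow> Y \<subseteq> X \<Longrightarrow> indep Y"
    and indep_augment: "indep X \<Longrightarrow> indep Y \<Longrightarrow> card X < card Y \<Longrightarrow> \<exists>y\<in>Y - X. indep (insert y X)"

definition basis :: "('a set \<Rightarrow> bool) \<Rightarrow> 'a set \<Rightarrow> bool" where
  "basis indep B \<longleftrightarrow> indep B \<and> (\<forall>X. indep X \<and> B \<subseteq> X \<longrightarrow> X = B)"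

definition circuit :: "'a set \<Rightarrow> ('a set \<Rightarrow> bool) \<Rightarrow> 'a set \<Rightarrow> bool" where
  "circuit E indep C \<longleftrightarrow> C \<subseteq> E \<and> \<not> indep C \<and> (\<forall>X. X \<subset> C \<longrightarrow> indep X)"

text \<open>Independent sets of the dual matroid, whose bases are the complements of bases.\<close>

definition dual_indep :: "'a set \<Rightarrow> ('a set \<Rightarrow> bool) \<Rightarrow> 'a set \<Rightarrow> bool" where
  "dual_indep E indep X \<longleftrightarrow> (\<exists>B. basis indep B \<and> X \<subseteq> E - B)"

definition ext_active :: "('a::linorder) set \<Rightarrow> ('a set \<Rightarrow> bool) \<Rightarrow> 'a set \<Rightarrow> 'a set" where
  "ext_active E indep S =
     {e \<in> E - S. \<exists>C. circuit E indep C \<and> C \<subseteq> insert e S \<and> e = Max C}"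

definition int_active :: "('a::linorder) set \<Rightarrow> ('a set \<Rightarrow> bool) \<Rightarrow> 'a set \<Rightarrow> 'a set" where
  "int_active E indep S = {i \<in> S. i \<in> ext_active E (dual_indep E indep) (E - S)}"

text \<open>For an independent set of a matroid the described basis exists and is unique.\<close>

definition related_basis :: "('a::linorder) set \<Rightarrow> ('a set \<Rightarrow> bool) \<Rightarrow> 'a set \<Rightarrow> 'a set" where
  "related_basis E indep I =
     (THE B. basis indep B \<and> (\<exists>Y. Y \<subseteq> int_active E indep B \<and> I = B - Y))"

definition broken_circuit :: "('a::linorder) set \<Rightarrow> ('a set \<Rightarrow> bool) \<Rightarrow> 'a set \<Rightarrow> bool" where
  "broken_circuit E indep X \<longleftrightarrow> (\<exists>C. circuit E indep C \<and> X = C - {Max C})"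

definition nbc_sets :: "('a::linorder) set \<Rightarrow> ('a set \<Rightarrow> bool) \<Rightarrow> 'a set set" where
  "nbc_sets E indep = {S. S \<subseteq> E \<and> \<not> (\<exists>X. broken_circuit E indep X \<and> X \<subseteq> S)}"

definition internally_related ::
    "('a::linorder) set \<Rightarrow> ('a set \<Rightarrow> bool) \<Rightarrow> 'a set \<Rightarrow> 'a set \<Rightarrow> bool" where
  "internally_related E indep I J \<longleftrightarrow> related_basis E indep I = related_basis E indep J"

definition ext_int_le ::
    "('a::linorder) set \<Rightarrow> ('a set \<Rightarrow> bool) \<Rightarrow> 'a set \<Rightarrow> 'a set \<Rightarrow> bool" where
  "ext_int_le E indep I J \<longleftrightarrow>
     (\<not> internally_related E indep I J \<and>
        (I - int_active E indep I) \<union> ext_active E indep I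
          \<subseteq> (J - int_active E indep J) \<union> ext_active E indep J)
     \<or> (internally_related E indep I J \<and> I \<subseteq> J)"

definition linear_extension_on ::
    "'b set \<Rightarrow> ('b \<Rightarrow> 'b \<Rightarrow> bool) \<Rightarrow> ('b \<times> 'b) set \<Rightarrow> bool" where
  "linear_extension_on A le r \<longleftrightarrow>
     linear_order_on A r \<and> (\<forall>x\<in>A. \<forall>y\<in>A. le x y \<longrightarrow> (x, y) \<in> r)"

definition listed_in_order :: "'b set \<Rightarrow> ('b \<times> 'b) set \<Rightarrow> 'b list \<Rightarrow> bool" where
  "listed_in_order A r xs \<longleftrightarrow>
     distinct xs \<and> set xs = A \<and> sorted_wrt (\<lambda>x y. (x, y) \<in> r) xs"

definition simplicial_complex :: "'v set \<Rightarrow> 'v set set \<Rightarrow> bool" where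
  "simplicial_complex V \<Delta> \<longleftrightarrow>
     finite V \<and> \<Delta> \<subseteq> Pow V \<and> (\<forall>F\<in>\<Delta>. \<forall>F'. F' \<subseteq> F \<longrightarrow> F' \<in> \<Delta>)"

definition facets :: "'v set set \<Rightarrow> 'v set set" where
  "facets \<Delta> = {F \<in> \<Delta>. \<forall>F'\<in>\<Delta>. F \<subseteq> F' \<longrightarrow> F' = F}"

definition pure_complex :: "'v set \<Rightarrow> 'v set set \<Rightarrow> bool" where
  "pure_complex V \<Delta> \<longleftrightarrow>
     simplicial_complex V \<Delta> \<and> (\<forall>F\<in>facets \<Delta>. \<forall>F'\<in>facets \<Delta>. card F = card F')"

definition shelling_order :: "'v set \<Rightarrow> 'v set set \<Rightarrow> 'v set list \<Rightarrow> bool" where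
  "shelling_order V \<Delta> Fs \<longleftrightarrow>
     pure_complex V \<Delta> \<and> distinct Fs \<and> set Fs = facets \<Delta> \<and>
     (\<forall>k < length Fs. \<forall>i < k. \<exists>j < k. \<exists>e \<in> Fs ! k.
        Fs ! i \<inter> Fs ! k \<subseteq> Fs ! j \<inter> Fs ! k \<and> Fs ! j \<inter> Fs ! k = Fs ! k - {e})"

datatype 'a vertex = y_vertex 'a | z_vertex 'a

definition aug_nbc_vertices :: "'a set \<Rightarrow> 'a vertex set" where
  "aug_nbc_vertices E = y_vertex ` E \<union> z_vertex ` E"

definition aug_nbc_facet ::
    "('a::linorder) set \<Rightarrow> ('a set \<Rightarrow> bool) \<Rightarrow> 'a set \<Rightarrow> 'a vertex set" where
  "aug_nbc_facet E indep I = y_vertex ` (related_basis E indep I - I) \<union> z_vertex ` I"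

text \<open>If the matroid has a loop, then the empty set is a broken circuit, there are no nbc sets,
  and the complex has no faces at all, not even the empty one.\<close>

definition aug_nbc_complex ::
    "('a::linorder) set \<Rightarrow> ('a set \<Rightarrow> bool) \<Rightarrow> 'a vertex set set" where
  "aug_nbc_complex E indep =
     {F. F \<subseteq> aug_nbc_vertices E \<and> (\<exists>I\<in>nbc_sets E indep. F \<subseteq> aug_nbc_facet E indep I)}"

end

theory Submission
  imports Defs
begin

text \<open>
  Writing \<open>B\<^sub>I\<close> for the related basis of an independent set \<open>I\<close>, the elements of \<open>B\<^sub>I - I\<close> being
  internally active says that \<open>B\<^sub>I\<close> is the greedy completion of \<open>I\<close> by the largest possible elements.
  Two facts give the shelling.  First, the set of internally passive elements is monotone
  and nbc sets have no externally active elements, so the external/internal order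
  extends inclusion on nbc sets.  Second, the greedy completion satisfies
  \<open>B\<^sub>K - {x} \<subseteq> B\<^sub>L\<close> for \<open>L = K - {x}\<close>.  Hence if \<open>I\<close> precedes \<open>K\<close>, then \<open>K\<close> is not contained
  in \<open>I\<close>, and for any \<open>x \<in> K - I\<close> the nbc set \<open>L = K - {x}\<close> precedes \<open>K\<close> and
  satisfies \<open>G(L) \<inter> G(K) = G(K) - {z\<^sub>x} \<supseteq> G(I) \<inter> G(K)\<close>.
\<close>

definition completes ::
    "('a::linorder) set \<Rightarrow> ('a set \<Rightarrow> bool) \<Rightarrow> 'a set \<Rightarrow> 'a set \<Rightarrow> bool" where
  "completes E indep I B \<longleftrightarrow> basis indep B \<and> I \<subseteq> B \<and> B - I \<subseteq> int_active E indep B"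

text \<open>Internally active elements of \<open>B\<close> lie in \<open>B\<close>, so
  \<open>I = B - Y\<close> forces \<open>Y = B - I\<close>, which removes the existential
  quantifier.\<close>

lemma related_basis_eq_The_completes:
  "related_basis E indep I = (THE B. completes E indep I B)"
proof -
  have "(\<exists>Y. Y \<subseteq> int_active E indep B \<and> I = B - Y) \<longleftrightarrow>
        I \<subseteq> B \<and> B - I \<subseteq> int_active E indep B" for B
    by (auto intro!: exI[of _ "B - I"])
  then show ?thesis
    by (simp add: related_basis_def completes_def)
qed

section \<open>Bases and exchange, without an order on the elements\<close>

context matroid
begin

lemma indep_finite: "indep X \<Longrightarrow> finite X"
  using finite_ground indep_subset_ground finite_subset by blast

lemma basis_indep: "basis indep B \<Longrightarrow> indep B"
  by (simp add: basis_def)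

lemma card_indep_le_basis:
  assumes "basis indep B" "indep X"
  shows "card X \<le> card B"
proof (rule ccontr)
  assume "\<not> card X \<le> card B"
  then obtain y where "y \<in> X - B" "indep (insert y B)"
    using indep_augment[of B X] assms basis_indep by auto
  then show False using assms(1) unfolding basis_def by blast
qed

lemma basis_iff_card:
  assumes "basis indep B"
  shows "basis indep X \<longleftrightarrow> indep X \<and> card X = card B"
proof
  assume "basis indep X"
  then show "indep X \<and> card X = card B"
    using assms card_indep_le_basis basis_indep by (meson le_antisym)
next
  assume "indep X \<and> card X = card B"
  then show "basis indep X"
    unfolding basis_def using card_indep_le_basis[OF assms] indep_finite
    by (metis card_seteq)
qed

lemma basis_exchange_iff:
  assumes "basis indep B" "i \<in> B" "e \<notin> B"
  shows "basis indep (insert e (B - {i})) \<longleftrightarrow> indep (insert e (B - {i}))"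
proof -
  have "finite B" using assms indep_finite basis_indep by blast
  then have "card (insert e (B - {i})) = card B"
    using assms by (metis Diff_iff card_Suc_Diff1 card_insert_disjoint finite_Diff)
  then show ?thesis using basis_iff_card[OF assms(1)] by blast
qed

lemma ex_basis_superset:
  assumes "indep I"
  shows "\<exists>B. basis indep B \<and> I \<subseteq> B"
proof -
  have "finite {X. indep X \<and> I \<subseteq> X}"
    using finite_ground indep_subset_ground by (auto intro: finite_subset[of _ "Pow E"])
  then obtain B where "B \<in> {X. indep X \<and> I \<subseteq> X}"
      "\<forall>X \<in> {X. indep X \<and> I \<subseteq> X}. B \<subseteq> X \<longrightarrow> B = X"
    using assms finite_has_maximal[of "{X. indep X \<and> I \<subseteq> X}"] by blast
  then show ?thesis unfolding basis_def by blast
qed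

text \<open>A maximal independent set \<open>Z\<close> between \<open>insert m X\<close> and
  \<open>insert m B\<close> has the size of \<open>B\<close> by augmentation. Since it contains
  \<open>m\<close>, it omits exactly one element of \<open>B\<close>, and that element is outside
  \<open>X\<close>.\<close>

lemma ex_basis_exchange:
  assumes B: "basis indep B" and X: "X \<subseteq> B" "indep (insert m X)" and m: "m \<notin> B"
  shows "\<exists>y\<in>B - X. indep (insert m (B - {y}))"
proof -
  let ?A = "{Z. insert m X \<subseteq> Z \<and> Z \<subseteq> insert m B \<and> indep Z}"
  have finB: "finite B" using B indep_finite basis_indep by blast
  then have "finite ?A" by (auto intro: finite_subset[of _ "Pow (insert m B)"])
  then obtain Z where Z: "Z \<in> ?A" "\<forall>W\<in>?A. Z \<subseteq> W \<longrightarrow> Z = W"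
    using X finite_has_maximal[of ?A] by blast
  have "card Z \<ge> card B"
  proof (rule ccontr)
    assume "\<not> card B \<le> card Z"
    then obtain y where "y \<in> B - Z" "indep (insert y Z)"
      using indep_augment[of Z B] Z(1) B basis_indep by auto
    then show False using Z(1) bspec[OF Z(2), of "insert y Z"] by blast
  qed
  then have "card Z = card B"
    using card_indep_le_basis[OF B] Z(1) by fastforce
  moreover have mZ: "Z = insert m (Z - {m})" "Z - {m} \<subseteq> B"
    using Z(1) by auto
  moreover have "finite Z" using Z(1) indep_finite by blast
  ultimately have "card (Z - {m}) < card B"
    by (metis card_Diff1_less insertI1)
  then have "\<not> B \<subseteq> Z - {m}"
    using \<open>finite Z\<close> card_mono[of "Z - {m}" B] by force
  then obtain y where y: "y \<in> B" "y \<notin> Z" using m by blast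
  have "card (insert m (B - {y})) = card Z"
    using y m finB \<open>card Z = card B\<close>
    by (metis Diff_iff card_Suc_Diff1 card_insert_disjoint finite_Diff)
  then have "Z = insert m (B - {y})"
    using mZ y finB by (intro card_subset_eq) auto
  then show ?thesis using Z(1) y by blast
qed

end

section \<open>Activities of nbc sets and inclusion\<close>

lemma nbc_sets_subset: "S \<in> nbc_sets E indep \<Longrightarrow> T \<subseteq> S \<Longrightarrow> T \<in> nbc_sets E indep"
  unfolding nbc_sets_def by blast

lemma ext_active_nbc:
  assumes "S \<in> nbc_sets E indep"
  shows "ext_active E indep S = {}"
proof -
  have False if "circuit E indep C" "C \<subseteq> insert e S" "e = Max C" for e C
    using that assms unfolding nbc_sets_def broken_circuit_def by blast
  then show ?thesis unfolding ext_active_def by blast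
qed

text \<open>Complements reverse inclusion, so a cocircuit witnessing the activity of an element in
  \<open>K\<close> is still a witness in \<open>J\<close>.\<close>

lemma int_active_antimono:
  "J \<subseteq> K \<Longrightarrow> int_active E indep K \<inter> J \<subseteq> int_active E indep J"
  unfolding int_active_def ext_active_def by blast

text \<open>By \<open>int_active_antimono\<close>, an element passive in \<open>J\<close> stays
  passive in \<open>K\<close>, and \<open>J\<close> has no externally active elements. This settles
  the first disjunct of the order; for internally related sets the inclusion itself
  suffices.\<close>

lemma ext_int_le_nbc_subset:
  assumes "K \<in> nbc_sets E indep" "J \<subseteq> K"
  shows "ext_int_le E indep J K"
proof -
  have "ext_active E indep J = {}"
    using assms nbc_sets_subset ext_active_nbc by metis
  then show ?thesis
    using int_active_antimono[OF assms(2), of E indep] assms(2)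
    unfolding ext_int_le_def by blast
qed

lemma aug_nbc_facet_eq_iff: "aug_nbc_facet E indep I = aug_nbc_facet E indep J \<longleftrightarrow> I = J"
proof
  have "I = {x. z_vertex x \<in> aug_nbc_facet E indep I}" for I
    unfolding aug_nbc_facet_def by auto
  then show "aug_nbc_facet E indep I = aug_nbc_facet E indep J \<Longrightarrow> I = J" by metis
qed simp

section \<open>Activities, for a matroid over a linearly ordered type\<close>

context
  fixes E :: "'a::linorder set" and indep :: "'a set \<Rightarrow> bool"
  assumes M: "matroid E indep"
begin

interpretation matroid E indep by (rule M)

text \<open>A minimal dependent subset is a circuit, and its broken circuit would lie in
  \<open>S\<close>.\<close>

lemma nbc_indep:
  assumes "S \<in> nbc_sets E indep"
  shows "indep S"
proof (rule ccontr)
  assume "\<not> indep S"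
  have S: "S \<subseteq> E" "finite S"
    using assms finite_ground finite_subset unfolding nbc_sets_def by auto
  let ?A = "{X. X \<subseteq> S \<and> \<not> indep X}"
  have "finite ?A" using S by simp
  then obtain C where "C \<in> ?A" "\<forall>X\<in>?A. X \<subseteq> C \<longrightarrow> C = X"
    using \<open>\<not> indep S\<close> finite_has_minimal[of ?A] by blast
  then have "circuit E indep C" "C - {Max C} \<subseteq> S"
    using S unfolding circuit_def by blast+
  then show False
    using assms unfolding nbc_sets_def broken_circuit_def by blast
qed

text \<open>Removes the dual matroid from the argument. If a larger \<open>e\<close> could replace
  \<open>i\<close>, the new basis would avoid the witnessing cocircuit, whose maximum is
  \<open>i\<close>, and make it dual independent. Conversely, the fundamental cocircuit of
  \<open>i\<close> is a witness.\<close>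

lemma int_active_basis_iff:
  assumes B: "basis indep B"
  shows "i \<in> int_active E indep B \<longleftrightarrow>
    i \<in> B \<and> (\<forall>e. e \<notin> B \<longrightarrow> i < e \<longrightarrow> \<not> indep (insert e (B - {i})))"
proof
  assume "i \<in> int_active E indep B"
  then obtain D where D: "circuit E (dual_indep E indep) D" "D \<subseteq> insert i (E - B)"
      "i = Max D" and i: "i \<in> B"
    unfolding int_active_def ext_active_def by blast
  have "\<not> indep (insert e (B - {i}))" if e: "e \<notin> B" "i < e" for e
  proof
    assume "indep (insert e (B - {i}))"
    then have "basis indep (insert e (B - {i}))"
      using basis_exchange_iff[OF B i e(1)] by simp
    moreover have "finite D" "D \<subseteq> E"
      using D(1) finite_ground finite_subset unfolding circuit_def by blast+
    then have "e \<notin> D" using D(3) e(2) Max_ge leD by blast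
    then have "D \<subseteq> E - insert e (B - {i})" using D(2) \<open>D \<subseteq> E\<close> by blast
    ultimately show False
      using D(1) unfolding circuit_def dual_indep_def by blast
  qed
  then show "i \<in> B \<and> (\<forall>e. e \<notin> B \<longrightarrow> i < e \<longrightarrow> \<not> indep (insert e (B - {i})))"
    using i by blast
next
  assume r: "i \<in> B \<and> (\<forall>e. e \<notin> B \<longrightarrow> i < e \<longrightarrow> \<not> indep (insert e (B - {i})))"
  then have i: "i \<in> B" by blast
  have BE: "B \<subseteq> E" "finite B"
    using B basis_indep indep_subset_ground indep_finite by blast+
  \<comment> \<open>the fundamental cocircuit of \<open>i\<close> with respect to \<open>B\<close>\<close>
  define D where "D = insert i {e \<in> E - B. indep (insert e (B - {i}))}"
  have DE: "D \<subseteq> E" "finite D"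
    using BE i finite_ground by (auto simp: D_def)
  have "Max D = i"
    using r DE(2) by (intro Max_eqI) (auto simp: D_def not_less[symmetric])
  moreover have "circuit E (dual_indep E indep) D"
    unfolding circuit_def
  proof (intro conjI allI impI)
    show "\<not> dual_indep E indep D"
    proof
      assume "dual_indep E indep D"
      then obtain B' where B': "basis indep B'" "D \<subseteq> E - B'"
        unfolding dual_indep_def by blast
      \<comment> \<open>A basis avoiding \<open>D\<close> would still augment
        \<open>B - {i}\<close>, but every element that can do so lies in \<open>D\<close>.\<close>
      have "card (B - {i}) < card B'"
        using B B'(1) i BE(2) basis_iff_card by (metis card_Diff1_less)
      then obtain y where y: "y \<in> B' - (B - {i})" "indep (insert y (B - {i}))"
        using indep_augment[of "B - {i}" B'] B B'(1) basis_indep indep_subset by blast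
      then have "y \<in> D"
        unfolding D_def using indep_subset_ground by blast
      then show False using y B'(2) by blast
    qed
    fix X assume "X \<subset> D"
    then obtain d where d: "d \<in> D" "d \<notin> X" "X \<subseteq> D" by blast
    \<comment> \<open>For \<open>d = i\<close> this is \<open>B\<close> itself; in every case the
      basis meets \<open>D\<close> only in \<open>d\<close>, hence misses \<open>X\<close>.\<close>
    have "basis indep (insert d (B - {i}))"
      using d(1) B i basis_exchange_iff[OF B i] unfolding D_def by (auto simp: insert_absorb)
    moreover have "X \<subseteq> E - insert d (B - {i})"
      using d DE(1) unfolding D_def by auto
    ultimately show "dual_indep E indep X" unfolding dual_indep_def by blast
  qed (rule DE)
  moreover have "D \<subseteq> insert i (E - B)" by (auto simp: D_def)
  ultimately show "i \<in> int_active E indep B"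
    using i BE(1) unfolding int_active_def ext_active_def by blast
qed

section \<open>Existence and uniqueness of the greedy completion\<close>

lemma completes_iff:
  "completes E indep I B \<longleftrightarrow> basis indep B \<and> I \<subseteq> B \<and>
     (\<forall>y\<in>B - I. \<forall>e. e \<notin> B \<longrightarrow> y < e \<longrightarrow> \<not> indep (insert e (B - {y})))"
  unfolding completes_def by (auto simp: int_active_basis_iff subset_iff)

lemma ex_completes:
  assumes "indep I"
  shows "\<exists>B. completes E indep I B"
proof -
  \<comment> \<open>Counting smaller ground elements turns the order into strictly increasing
    weights, so a basis above \<open>I\<close> of maximal total weight admits no exchange for a
    larger element.\<close>
  define w where "w B = (\<Sum>b\<in>B. card {x \<in> E. x < b})" for B
  let ?A = "{B. basis indep B \<and> I \<subseteq> B}"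
  have "finite ?A"
    using finite_ground indep_subset_ground basis_indep
    by (auto intro!: finite_subset[of _ "Pow E"])
  moreover have "?A \<noteq> {}" using ex_basis_superset[OF assms] by blast
  ultimately have "Max (w ` ?A) \<in> w ` ?A" "\<forall>B'\<in>?A. w B' \<le> Max (w ` ?A)"
    by (auto intro: Max_in)
  then obtain B where B: "B \<in> ?A" "\<forall>B'\<in>?A. w B' \<le> w B"
    by (elim imageE) simp
  have "\<not> indep (insert e (B - {y}))" if y: "y \<in> B - I" and e: "e \<notin> B" "y < e" for y e
  proof
    assume ind: "indep (insert e (B - {y}))"
    then have "insert e (B - {y}) \<in> ?A"
      using B(1) y e basis_exchange_iff[of B y e] by blast
    then have le: "w (insert e (B - {y})) \<le> w B" using B(2) by blast
    have fin: "finite B" "y \<in> E"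
      using B(1) y basis_indep indep_finite indep_subset_ground by blast+
    have "{x \<in> E. x < y} \<subset> {x \<in> E. x < e}" using e fin by auto
    then have "card {x \<in> E. x < y} < card {x \<in> E. x < e}"
      using finite_ground by (intro psubset_card_mono) auto
    moreover have "w B = card {x \<in> E. x < y} + w (B - {y})"
      unfolding w_def using fin y by (intro sum.remove) auto
    moreover have "w (insert e (B - {y})) = card {x \<in> E. x < e} + w (B - {y})"
      unfolding w_def using fin e by simp
    ultimately show False using le by linarith
  qed
  then show ?thesis using B(1) completes_iff by blast
qed

text \<open>At the topmost difference \<open>m\<close>, exchange brings \<open>m\<close> into
  \<open>B\<close> while keeping \<open>I\<close> and everything of \<open>B\<close> above
  \<open>m\<close>. The element expelled is then a smaller one outside \<open>I\<close>,
  contradicting greediness of \<open>B\<close>.\<close>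

lemma completes_not_Max_diff:
  assumes B: "completes E indep I B" and B': "completes E indep I B'"
    and m: "m \<in> B' - B" and agree: "\<And>x. m < x \<Longrightarrow> x \<in> B \<longleftrightarrow> x \<in> B'"
  shows False
proof -
  have bB: "basis indep B" "I \<subseteq> B" and bB': "basis indep B'" "I \<subseteq> B'"
    using B B' completes_def by blast+
  define X where "X = I \<union> {x \<in> B. m < x}"
  have "insert m X \<subseteq> B'" using agree bB' m unfolding X_def by blast
  then have "indep (insert m X)" using bB'(1) basis_indep indep_subset by blast
  moreover have "X \<subseteq> B" using bB unfolding X_def by blast
  ultimately obtain y where "y \<in> B - X" "indep (insert m (B - {y}))"
    using ex_basis_exchange[OF bB(1)] m by blast
  moreover from this have "y \<in> B - I" "y < m"
    using m unfolding X_def by (auto simp: not_less le_less)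
  ultimately show False using B m completes_iff by blast
qed

lemma completes_unique:
  assumes B: "completes E indep I B" and B': "completes E indep I B'"
  shows "B = B'"
proof (rule ccontr)
  assume ne: "B \<noteq> B'"
  define D where "D = (B - B') \<union> (B' - B)"
  have "finite B" "finite B'"
    using B B' basis_indep indep_finite completes_def by blast+
  then have D: "finite D" "D \<noteq> {}" using ne unfolding D_def by auto
  have agree: "x \<in> B \<longleftrightarrow> x \<in> B'" if "Max D < x" for x
    using that D(1) Max_ge[of D x] unfolding D_def by fastforce
  \<comment> \<open>The maximum may lie in either basis, so the preceding lemma is used in both
    directions.\<close>
  have "Max D \<in> D" using D by simp
  then show False
    using completes_not_Max_diff[OF B B'] completes_not_Max_diff[OF B' B] agree
    unfolding D_def by blast
qed

lemma related_basis_eqI: "completes E indep I B \<Longrightarrow> related_basis E indep I = B"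
  unfolding related_basis_eq_The_completes by (rule the_equality) (auto dest: completes_unique)

lemma completes_related_basis:
  "indep I \<Longrightarrow> completes E indep I (related_basis E indep I)"
  using ex_completes[of I] related_basis_eqI by force

section \<open>Effect on the related basis of deleting one element\<close>

text \<open>Once \<open>i\<close> is released, the greedy choice swaps it for the largest possible
  \<open>e\<close>. An improving exchange of \<open>y\<close> for \<open>f\<close> in the new basis
  is traced back to a forbidden exchange in \<open>B\<close>, according to the position of
  \<open>y\<close> relative to \<open>e\<close>.\<close>

lemma completes_exchange:
  assumes c: "completes E indep K B" and i: "i \<in> K"
    and e: "e \<notin> B" "i < e" "indep (insert e (B - {i}))"
    and emax: "\<And>f. f \<notin> B \<Longrightarrow> e < f \<Longrightarrow> \<not> indep (insert f (B - {i}))"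
  shows "completes E indep (K - {i}) (insert e (B - {i}))"
proof -
  let ?B' = "insert e (B - {i})"
  have B: "basis indep B" "K \<subseteq> B" and iB: "i \<in> B"
    and act: "\<And>y f. y \<in> B - K \<Longrightarrow> f \<notin> B \<Longrightarrow> y < f \<Longrightarrow> \<not> indep (insert f (B - {y}))"
    using c i completes_iff by blast+
  have indB: "indep B" "finite B" using B basis_indep indep_finite by blast+
  have bB': "basis indep ?B'" using basis_exchange_iff[OF B(1) iB e(1)] e(3) by blast
  have "\<not> indep (insert f (?B' - {y}))"
    if y: "y \<in> ?B' - (K - {i})" and f: "f \<notin> ?B'" "y < f" for y f
  proof
    assume ind: "indep (insert f (?B' - {y}))"
    consider "y = e" | "y \<in> B - K" "y \<noteq> i" "e < y" | "y \<in> B - K" "y \<noteq> i" "y < e"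
      using y by (metis Diff_iff insertE insertI1 linorder_neqE)
    then show False
    proof cases
      case 1
      then have "?B' - {y} = B - {i}" using e(1) by auto
      moreover have "f \<notin> B" using 1 f e(2) by auto
      ultimately show False using ind emax[of f] f(2) 1 by simp
    next
      case 2
      have fB: "f \<notin> B" "e < f" using 2 f e(2) by auto
      \<comment> \<open>Without \<open>e\<close> the set is one element short of a basis, so
        \<open>i\<close> or \<open>y\<close> can be put back. The first contradicts greediness of
        \<open>B\<close> at \<open>y\<close>, the second the maximality of \<open>e\<close>.\<close>
      let ?X = "insert f (B - {i} - {y})"
      have "indep ?X" by (rule indep_subset[OF ind]) auto
      moreover have "card ?X < card B"
      proof -
        have "card (B - {i} - {y}) = card (B - {i}) - 1" "card (B - {i}) = card B - 1"
          using indB(2) iB 2 by auto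
        moreover have "card (B - {i}) > 0"
          using indB(2) 2 by (metis DiffE DiffI card_gt_0_iff empty_iff finite_Diff singletonD)
        moreover have "card ?X = Suc (card (B - {i} - {y}))" using fB indB(2) by simp
        ultimately show ?thesis by linarith
      qed
      ultimately obtain g where g: "g \<in> B - ?X" "indep (insert g ?X)"
        using indep_augment indB(1) by blast
      then consider "g = i" | "g = y" by blast
      then show False
      proof cases
        case 1
        then have "insert g ?X = insert f (B - {y})" using iB 2 by auto
        then show False using g(2) act[of y f] 2 fB f(2) by simp
      next
        case _: 2
        then have "insert g ?X = insert f (B - {i})" using iB 2 by auto
        then show False using g(2) emax[OF fB] by simp
      qed
    next
      case 3
      \<comment> \<open>Here both \<open>e\<close> and \<open>f\<close> exceed \<open>y\<close>, so
        neither can replace \<open>y\<close> in \<open>B\<close>. Yet augmenting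
        \<open>B - {y}\<close> from the exchanged basis would have to add one of them.\<close>
      have ne: "\<not> indep (insert e (B - {y}))" using act[of y e] 3 e(1) by blast
      have "f \<noteq> i"
      proof
        assume "f = i"
        then have "insert f (?B' - {y}) = insert e (B - {y})" using iB 3 e(1) by auto
        then show False using ind ne by simp
      qed
      then have fB: "f \<notin> B" using f by blast
      have nf: "\<not> indep (insert f (B - {y}))" using act[of y f] 3 fB f(2) by blast
      have "basis indep (insert f (?B' - {y}))"
        using basis_exchange_iff[OF bB' _ f(1), of y] ind y by blast
      then have "card (insert f (?B' - {y})) = card B"
        using basis_iff_card[OF B(1)] by blast
      moreover have "card (B - {y}) < card B" using card_Diff1_less[OF indB(2)] 3 by blast
      moreover have "indep (B - {y})" using indB(1) indep_subset by blast
      ultimately obtain g where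
          g: "g \<in> insert f (?B' - {y}) - (B - {y})" "indep (insert g (B - {y}))"
        using indep_augment[OF _ ind, of "B - {y}"] by auto
      then have "g = f \<or> g = e" by blast
      then show False using g(2) ne nf by blast
    qed
  qed
  then show ?thesis using completes_iff bB' B(2) by blast
qed

text \<open>Either no larger element can replace \<open>i\<close> and the basis is unchanged, or
  \<open>completes_exchange\<close> applies with the largest such element. Only \<open>i\<close> can
  leave the basis.\<close>

lemma related_basis_Diff_singleton:
  assumes K: "indep K" and i: "i \<in> K"
  shows "related_basis E indep K - {i} \<subseteq> related_basis E indep (K - {i})"
proof -
  define B where "B = related_basis E indep K"
  have c: "completes E indep K B" unfolding B_def by (rule completes_related_basis[OF K])
  let ?A = "{e. e \<notin> B \<and> i < e \<and> indep (insert e (B - {i}))}"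
  show ?thesis
  proof (cases "?A = {}")
    case True
    then have "completes E indep (K - {i}) B" using c unfolding completes_iff by blast
    then show ?thesis using related_basis_eqI B_def by blast
  next
    case False
    have fin: "finite ?A"
      using indep_subset_ground finite_ground by (auto intro!: finite_subset[of ?A E])
    define e where "e = Max ?A"
    have "e \<in> ?A" unfolding e_def using fin False by (rule Max_in)
    moreover have "\<not> indep (insert f (B - {i}))" if "f \<notin> B" "e < f" for f
    proof
      assume "indep (insert f (B - {i}))"
      then have "f \<in> ?A" using that \<open>e \<in> ?A\<close> by auto
      then have "f \<le> e" unfolding e_def by (rule Max_ge[OF fin])
      then show False using that(2) by simp
    qed
    ultimately have "completes E indep (K - {i}) (insert e (B - {i}))"
      using completes_exchange[OF c i] by blast
    then show ?thesis using related_basis_eqI B_def by blast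
  qed
qed

section \<open>Facets and purity of the augmented nbc complex\<close>

lemma aug_nbc_facet_finite_card:
  assumes "indep I"
  shows "finite (aug_nbc_facet E indep I)"
    and "card (aug_nbc_facet E indep I) = card (related_basis E indep I)"
proof -
  let ?B = "related_basis E indep I"
  have B: "I \<subseteq> ?B" "finite ?B"
    using completes_related_basis[OF assms] basis_indep indep_finite completes_def by blast+
  then have fin: "finite I" "finite (?B - I)" using finite_subset by auto
  then show "finite (aug_nbc_facet E indep I)" unfolding aug_nbc_facet_def by simp
  have "card (aug_nbc_facet E indep I) = card (?B - I) + card I"
    unfolding aug_nbc_facet_def using fin
    by (subst card_Un_disjoint) (auto simp: card_image inj_on_def)
  then show "card (aug_nbc_facet E indep I) = card ?B"
    using B fin(1) by (simp add: card_Diff_subset card_mono)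
qed

lemma card_aug_nbc_facet_eq:
  assumes "indep I" "indep J"
  shows "card (aug_nbc_facet E indep I) = card (aug_nbc_facet E indep J)"
proof -
  have "basis indep (related_basis E indep I)" "basis indep (related_basis E indep J)"
    using assms completes_related_basis completes_def by blast+
  then show ?thesis
    using assms aug_nbc_facet_finite_card(2) basis_iff_card by metis
qed

lemma aug_nbc_facet_subset_vertices:
  assumes "indep I"
  shows "aug_nbc_facet E indep I \<subseteq> aug_nbc_vertices E"
proof -
  have "I \<subseteq> related_basis E indep I" "related_basis E indep I \<subseteq> E"
    using completes_related_basis[OF assms] basis_indep indep_subset_ground completes_def
    by blast+
  then show ?thesis unfolding aug_nbc_facet_def aug_nbc_vertices_def by auto
qed

text \<open>All the sets \<open>aug_nbc_facet E indep I\<close> are finite of the same size, so none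
  is properly contained in another.\<close>

lemma facets_aug_nbc_complex:
  "facets (aug_nbc_complex E indep) = aug_nbc_facet E indep ` nbc_sets E indep"
proof
  have mem: "aug_nbc_facet E indep I \<in> aug_nbc_complex E indep" if "I \<in> nbc_sets E indep" for I
    unfolding aug_nbc_complex_def
    using that aug_nbc_facet_subset_vertices nbc_indep by blast
  show "facets (aug_nbc_complex E indep) \<subseteq> aug_nbc_facet E indep ` nbc_sets E indep"
  proof
    fix F assume F: "F \<in> facets (aug_nbc_complex E indep)"
    then obtain I where "I \<in> nbc_sets E indep" "F \<subseteq> aug_nbc_facet E indep I"
      unfolding facets_def aug_nbc_complex_def by blast
    then show "F \<in> aug_nbc_facet E indep ` nbc_sets E indep"
      using F mem unfolding facets_def by blast
  qed
  show "aug_nbc_facet E indep ` nbc_sets E indep \<subseteq> facets (aug_nbc_complex E indep)"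
  proof
    fix F assume "F \<in> aug_nbc_facet E indep ` nbc_sets E indep"
    then obtain I where I: "I \<in> nbc_sets E indep" "F = aug_nbc_facet E indep I" by blast
    have "F' = F" if F': "F' \<in> aug_nbc_complex E indep" "F \<subseteq> F'" for F'
    proof -
      obtain J where J: "J \<in> nbc_sets E indep" "F' \<subseteq> aug_nbc_facet E indep J"
        using F' unfolding aug_nbc_complex_def by blast
      have "F = aug_nbc_facet E indep J"
        using F'(2) J I nbc_indep card_aug_nbc_facet_eq aug_nbc_facet_finite_card(1)
        by (intro card_subset_eq) auto
      then show ?thesis using F'(2) J(2) by blast
    qed
    then show "F \<in> facets (aug_nbc_complex E indep)"
      using mem I unfolding facets_def by blast
  qed
qed

lemma pure_aug_nbc_complex: "pure_complex (aug_nbc_vertices E) (aug_nbc_complex E indep)"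
proof -
  have "simplicial_complex (aug_nbc_vertices E) (aug_nbc_complex E indep)"
    unfolding simplicial_complex_def
    using finite_ground by (auto simp: aug_nbc_vertices_def aug_nbc_complex_def)
  then show ?thesis
    unfolding pure_complex_def facets_aug_nbc_complex
    using card_aug_nbc_facet_eq nbc_indep by blast
qed

text \<open>The y-vertices for \<open>K\<close> survive because deletion can cost the related basis
  only \<open>x\<close>, and \<open>x\<close> is not in \<open>?B K - K\<close>. Among the
  z-vertices only that of \<open>x\<close> is lost.\<close>

lemma aug_nbc_facet_Int_Diff_singleton:
  assumes "indep K" "x \<in> K"
  shows "aug_nbc_facet E indep (K - {x}) \<inter> aug_nbc_facet E indep K =
    aug_nbc_facet E indep K - {z_vertex x}"
proof -
  let ?B = "related_basis E indep"
  have "(?B (K - {x}) - (K - {x})) \<inter> (?B K - K) = ?B K - K"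
    using related_basis_Diff_singleton[OF assms] assms(2) by blast
  then have "y_vertex ` (?B (K - {x}) - (K - {x})) \<inter> y_vertex ` (?B K - K) = y_vertex ` (?B K - K)"
    by (metis image_Int injI vertex.inject(1))
  then show ?thesis unfolding aug_nbc_facet_def by blast
qed

end

theorem theorem7p3:
  fixes E :: "('a::linorder) set" and indep :: "'a set \<Rightarrow> bool"
    and prec :: "('a set \<times> 'a set) set" and Is :: "'a set list"
  assumes "matroid E indep"
    and "linear_extension_on (nbc_sets E indep) (ext_int_le E indep) prec"
    and "listed_in_order (nbc_sets E indep) prec Is"
  shows "shelling_order (aug_nbc_vertices E) (aug_nbc_complex E indep)
           (map (aug_nbc_facet E indep) Is)"
proof -
  let ?G = "aug_nbc_facet E indep"
  have dist: "distinct Is" and set: "set Is = nbc_sets E indep"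
    and "sorted_wrt (\<lambda>I J. (I, J) \<in> prec) Is"
    using assms(3) unfolding listed_in_order_def by simp_all
  then have sorted: "(Is ! a, Is ! b) \<in> prec" if "a < b" "b < length Is" for a b
    using that sorted_wrt_nth_less by metis
  have anti: "antisym prec"
    using assms(2)
    unfolding linear_extension_on_def linear_order_on_def partial_order_on_def by blast
  have ext: "(I, J) \<in> prec" if "I \<in> set Is" "J \<in> set Is" "ext_int_le E indep I J" for I J
    using assms(2) that unfolding set linear_extension_on_def by blast
  \<comment> \<open>Proper inclusion gives a pair in \<open>prec\<close>; the opposite list position
    would give the reversed pair, contradicting antisymmetry.\<close>
  have before: "a < b"
    if "a < length Is" "b < length Is" "Is ! a \<subset> Is ! b" for a b
  proof (rule ccontr)
    assume "\<not> a < b"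
    moreover have "a \<noteq> b" using that by blast
    ultimately have "(Is ! b, Is ! a) \<in> prec" using sorted that by simp
    moreover have "(Is ! a, Is ! b) \<in> prec"
      using ext ext_int_le_nbc_subset that set nth_mem by (metis psubset_imp_subset)
    ultimately show False using anti that(3) by (auto dest: antisymD)
  qed
  let ?Gs = "map ?G Is"
  have "\<exists>j<k. \<exists>e\<in>?Gs ! k. ?Gs ! i \<inter> ?Gs ! k \<subseteq> ?Gs ! j \<inter> ?Gs ! k \<and>
          ?Gs ! j \<inter> ?Gs ! k = ?Gs ! k - {e}"
    if k: "k < length Is" and i: "i < k" for k i
  proof -
    let ?I = "Is ! i" and ?K = "Is ! k"
    have "?I \<noteq> ?K" using dist k i by (simp add: nth_eq_iff_index_eq)
    then have "\<not> ?K \<subseteq> ?I" using before[of k i] k i by auto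
    then obtain x where x: "x \<in> ?K" "x \<notin> ?I" by blast
    have K: "?K \<in> nbc_sets E indep" using set k nth_mem by blast
    then have "?K - {x} \<in> set Is" using nbc_sets_subset set by blast
    then obtain j where j: "j < length Is" "Is ! j = ?K - {x}" by (auto simp: in_set_conv_nth)
    have "j < k" using before[OF j(1) k] j(2) x(1) by auto
    moreover have "?G (Is ! j) \<inter> ?G ?K = ?G ?K - {z_vertex x}"
      using aug_nbc_facet_Int_Diff_singleton[OF assms(1) nbc_indep[OF assms(1) K] x(1)] j(2)
      by simp
    \<comment> \<open>The shelling vertex is \<open>z_vertex x\<close>: its absence from
      \<open>?G ?I\<close> gives the required inclusion of intersections.\<close>
    moreover have "z_vertex x \<in> ?G ?K" "z_vertex x \<notin> ?G ?I"
      using x unfolding aug_nbc_facet_def by auto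
    moreover have "?Gs ! i = ?G ?I" "?Gs ! j = ?G (Is ! j)" "?Gs ! k = ?G ?K"
      using i j(1) k by simp_all
    ultimately show ?thesis
      by (intro exI[of _ j] conjI bexI[of _ "z_vertex x"]) auto
  qed
  moreover have "distinct ?Gs"
    using dist by (simp add: distinct_map inj_on_def aug_nbc_facet_eq_iff)
  moreover have "set ?Gs = facets (aug_nbc_complex E indep)"
    using set facets_aug_nbc_complex[OF assms(1)] by simp
  ultimately show ?thesis
    unfolding shelling_order_def using pure_aug_nbc_complex[OF assms(1)] by simp
qed

end
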